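(* Let $c_0=\frac{8001}{16000}$. Let $D$ be an admissible seed of order $n\ge 400001$ with $d=|D|$ queens. Then $$\frac{d+1}{n}>c_0+\frac{1-c_0}{n}>c_0 .$$ If in addition $D$ is independent, then $$\frac{d+2}{n}>c_0+\frac{2-c_0}{n}>c_0 .$$ Consequently, for every sequence $(D_i)$ of admissible seeds, with orders $n_i\to\infty$ and sizes $d_i=|D_i|$, one has $\liminf_{i\to\infty}\frac{d_i+1}{n_i}\ge\frac12+\frac1{16000}$; and if all $D_i$ are independent, then also $\liminf_{i\to\infty}\frac{d_i+2}{n_i}\ge\frac12+\frac1{16000}$.
   Context: For odd $n$, the squares of the $n\times n$ board are the pairs $(X,Y)$ of integers with $|X|,|Y|\le (n-1)/2$. Write $k=(n-1)/4$ (an integer or half-integer). The lines are columns ($X$ constant), rows ($Y$ constant), difference diagonals (index $Y-X$ constant) and sum diagonals (index $X+Y$ constant). A set $D$ of squares (queens) occupies a line if it contains a square of it. The two long diagonals are $Y-X=0$ and $X+Y=0$. For $p\in\{0,1\}$, $D$ is $p$-orthodox if every row and every column whose index has parity $p$ is occupied. A $p$-orthodox set is a $p$-cover if every square with both coordinates of parity $1-p$ lies on an occupied diagonal. For a set meeting both long diagonals, define $e$ to be the largest integer $\ge 0$ such that all difference diagonals of index $2i$, $|i|\le e$, are occupied; $f$ the largest integer $\ge0$ such that all sum diagonals of index $2i$, $|i|\le f$, are occupied; and $u$ the largest nonnegative integer such that the difference diagonals of index $\pm(2e+4j)$ and the sum diagonals of index $\pm(2f+4j)$ are all occupied for $1\le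 j\le u$. A $p$-cover meeting both long diagonals is of Type A if $e+f\equiv p\pmod 2$ and $e+f+2u\ge 2k-2$. An admissible seed of order $n$ is a Type-A $p$-cover $D$ of the odd board of order $n$ (so both long diagonals are occupied), all of whose queens lie on interior squares (not in the first or last row or column), where either $p=1$ and $n\equiv1\pmod4$, or $p=0$ and $n\equiv3\pmod4$. $D$ is independent if no two distinct queens of $D$ share a row, column, difference diagonal or sum diagonal. (The numbers $(d+1)/n$ and $(d+2)/n$ are the coefficients that a classical amplification construction attaches to the seed for ordinary and independent queen domination.) *)

theory Defs
  imports Complex_Main "HOL-Library.Extended_Real"
begin

type_synonym square = "int \<times> int"

text \<open>
  A square is a pair \<open>(X, Y)\<close> of column and row index. For odd \<open>n\<close> the bound
  \<open>2 * \<bar>X\<bar> \<le> n - 1\<close> is \<open>\<bar>X\<bar> \<le> (n - 1) / 2\<close>.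
\<close>

definition board :: "nat \<Rightarrow> square set" where
  "board n = {(x, y). 2 * \<bar>x\<bar> \<le> int n - 1 \<and> 2 * \<bar>y\<bar> \<le> int n - 1}"

definition interior_squares :: "nat \<Rightarrow> square set" where
  "interior_squares n = {(x, y). 2 * \<bar>x\<bar> < int n - 1 \<and> 2 * \<bar>y\<bar> < int n - 1}"

definition column :: "nat \<Rightarrow> int \<Rightarrow> square set" where
  "column n a = {(x, y) \<in> board n. x = a}"

definition row :: "nat \<Rightarrow> int \<Rightarrow> square set" where
  "row n b = {(x, y) \<in> board n. y = b}"

definition diff_diag :: "nat \<Rightarrow> int \<Rightarrow> square set" where
  "diff_diag n m = {(x, y) \<in> board n. y - x = m}"

definition sum_diag :: "nat \<Rightarrow> int \<Rightarrow> square set" where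
  "sum_diag n m = {(x, y) \<in> board n. x + y = m}"

text \<open>Lines of out-of-range index are empty, hence never occupied.\<close>

definition occupies :: "square set \<Rightarrow> square set \<Rightarrow> bool" where
  "occupies D L \<longleftrightarrow> D \<inter> L \<noteq> {}"

text \<open>The parity \<open>p\<close> below is meant to be 0 or 1.\<close>

definition orthodox :: "nat \<Rightarrow> int \<Rightarrow> square set \<Rightarrow> bool" where
  "orthodox n p D \<longleftrightarrow> D \<subseteq> board n \<and>
     (\<forall>a. 2 * \<bar>a\<bar> \<le> int n - 1 \<and> a mod 2 = p \<longrightarrow>
        occupies D (column n a) \<and> occupies D (row n a))"

definition p_cover :: "nat \<Rightarrow> int \<Rightarrow> square set \<Rightarrow> bool" where
  "p_cover n p D \<longleftrightarrow> orthodox n p D \<and>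
     (\<forall>(x, y) \<in> board n. x mod 2 = 1 - p \<and> y mod 2 = 1 - p \<longrightarrow>
        occupies D (diff_diag n (y - x)) \<or> occupies D (sum_diag n (x + y)))"

definition meets_long_diagonals :: "nat \<Rightarrow> square set \<Rightarrow> bool" where
  "meets_long_diagonals n D \<longleftrightarrow> occupies D (diff_diag n 0) \<and> occupies D (sum_diag n 0)"

text \<open>
  The maxima \<open>e\<close>, \<open>f\<close>, \<open>u\<close> exist when \<open>D\<close> meets both long diagonals, since only
  finitely many diagonals are nonempty. They are used only in that case.
\<close>

definition e_par :: "nat \<Rightarrow> square set \<Rightarrow> nat" where
  "e_par n D = (GREATEST e. \<forall>i. \<bar>i\<bar> \<le> int e \<longrightarrow> occupies D (diff_diag n (2 * i)))"

definition f_par :: "nat \<Rightarrow> square set \<Rightarrow> nat" where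
  "f_par n D = (GREATEST f. \<forall>i. \<bar>i\<bar> \<le> int f \<longrightarrow> occupies D (sum_diag n (2 * i)))"

definition u_par :: "nat \<Rightarrow> square set \<Rightarrow> nat" where
  "u_par n D = (GREATEST u. \<forall>j\<in>{1..u}.
     (let a = 2 * int (e_par n D) + 4 * int j; b = 2 * int (f_par n D) + 4 * int j in
        occupies D (diff_diag n a) \<and> occupies D (diff_diag n (- a)) \<and>
        occupies D (sum_diag n b) \<and> occupies D (sum_diag n (- b))))"

definition k_par :: "nat \<Rightarrow> real" where
  "k_par n = (real n - 1) / 4"

definition type_A_cover :: "nat \<Rightarrow> int \<Rightarrow> square set \<Rightarrow> bool" where
  "type_A_cover n p D \<longleftrightarrow> p_cover n p D \<and> meets_long_diagonals n D \<and>
     (int (e_par n D) + int (f_par n D)) mod 2 = p \<and>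
     real (e_par n D) + real (f_par n D) + 2 * real (u_par n D) \<ge> 2 * k_par n - 2"

definition admissible_seed :: "nat \<Rightarrow> square set \<Rightarrow> bool" where
  "admissible_seed n D \<longleftrightarrow> D \<subseteq> interior_squares n \<and>
     (\<exists>p. type_A_cover n p D \<and> (p = 1 \<and> n mod 4 = 1 \<or> p = 0 \<and> n mod 4 = 3))"

definition independent_queens :: "square set \<Rightarrow> bool" where
  "independent_queens D \<longleftrightarrow>
     (\<forall>(x, y) \<in> D. \<forall>(x', y') \<in> D. (x, y) \<noteq> (x', y') \<longrightarrow>
        x \<noteq> x' \<and> y \<noteq> y' \<and> y - x \<noteq> y' - x' \<and> x + y \<noteq> x' + y')"

definition c0 :: real where
  "c0 = 8001 / 16000"

end

theory Submission
  imports Defs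
begin

text \<open>
  Write $n = 2N + 1$ and $d = |D|$. The boundary rows and columns have parity $1 - p$, so exactly
  $N$ columns and $N$ rows must be occupied, and $d \ge N$ is trivial. The claim
  $d > c_0 (n - 1)$ says $d > N + N/8000$: the trivial bound is never nearly attained.
  By parity the Type A inequality improves to $e + f + 2u \ge N - 1$, and the parameters can be
  decreased until equality holds. Hence difference diagonals of
  index $2i$ are occupied for two families of $i$, each an arithmetic progression of step 2
  symmetric about 0: a wide one with $N - f$ members and a core one with $e$ members. The sum
  diagonals have the same structure with $e$ and $f$ exchanged. Altogether $2N$ diagonals are
  required, so near equality almost every queen uses up one required line of each of the four kinds.

  All lower bounds come from one principle, weak duality for the linear program ``cover all required
  lines with few queens'': if the required lines carry nonnegative weights
  such that the lines through any one square have total weight at most 1, then $d$ is at least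
  the sum of all weights (\<open>total_weight_le_card\<close>). Suppose $d \le N + N/8000$.

  \<^item> Weight 1 on the diagonals of one direction gives $|e - f| \le N/8000$.
  \<^item> The parallelogram law $(y-x)^2 + (x+y)^2 = 2x^2 + 2y^2$ yields two weightings whose weights
    add up to exactly 1 on every square all of whose lines are required, one with quadratic weights increasing
    on columns and one with them decreasing. Together they pin down the
    sum of the squares of the diagonal indices, which forces
    $(N - e)/N$ and $(N - f)/N$ to be close to $(1 + 1/\sqrt 3)/2 \approx 0.7887$.
  \<^item> For such $e$ and $f$ the first two moments are consistent, and a finer weighting is needed.
    In the coordinates $x/N$ it is piecewise quadratic, and it gives wide and core diagonals
    different weights. A queen on required diagonals of both directions sits in a row and a column of parity $p$
    only if the two diagonals are both wide or both core, and core queens lie in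
    the square $|y - x|, |x + y| \le 2 \max(e, f)$. The weights exploit this: their
    total is at least $1.0004\,N - 8$, a contradiction once $N \ge 200000$.
\<close>

section \<open>The weight functions\<close>

text \<open>
  The weights of the third kind, for a board scaled to $[-1,1]^2$. They have the shape of
  a numerical optimum of the dual linear program for large $N$ and $e = f$. Up to
  scaling by $3/2$, additive constants and a multiple of the parallelogram law, they are
  the functions \<open>col_profile\<close> for rows and columns, \<open>wide_profile\<close> for wide diagonals and
  $-v^2$ for core diagonals.
\<close>

definition ramp :: "real \<Rightarrow> real" where "ramp x = max 0 x"

text \<open>
  A parabola near 0 (it balances the core weight $-v^2$ by the parallelogram law) followed by a
  straight line. The slope drops at the knot $27/100$ from $108/100$ to $80/100$; for core
  queens beyond the knot this only lowers the total.
\<close>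

definition col_profile :: "real \<Rightarrow> real" where
  "col_profile x = 2 * x^2 - 2 * (ramp (\<bar>x\<bar> - 27/100))^2 - 7/25 * ramp (\<bar>x\<bar> - 27/100)"

text \<open>
  Flat up to $3/5$, then a concave parabola up to $9/10$, then a line whose slope $-4/5$ is opposite
  to the slope of the outer part of \<open>col_profile\<close>. Thus the total is constant where $x, y \ge 27/100$,
  $x + y \ge 9/10$ and $|x - y| \le 3/5$.
\<close>

definition wide_profile :: "real \<Rightarrow> real" where
  "wide_profile v = (ramp (\<bar>v\<bar> - 9/10))^2 - (ramp (\<bar>v\<bar> - 3/5))^2 - 1/5 * ramp (\<bar>v\<bar> - 9/10)"

lemma col_profile_inner: "\<bar>x\<bar> \<le> 27/100 \<Longrightarrow> col_profile x = 2 * x^2"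
  by (simp add: col_profile_def ramp_def)

lemma col_profile_outer: "\<bar>x\<bar> \<ge> 27/100 \<Longrightarrow> col_profile x = 4/5 * \<bar>x\<bar> - 351/5000"
proof -
  assume a: "\<bar>x\<bar> \<ge> 27/100"
  have "x^2 = \<bar>x\<bar>^2" by simp
  then show ?thesis using a unfolding col_profile_def ramp_def max_def
    by (simp add: power2_eq_square field_simps)
qed

lemma col_profile_le_square: "col_profile x \<le> 2 * x^2"
proof -
  have "0 \<le> ramp (\<bar>x\<bar> - 27/100)" by (simp add: ramp_def)
  then show ?thesis using zero_le_power2[of "ramp (\<bar>x\<bar> - 27/100)"]
    unfolding col_profile_def by linarith
qed

lemma wide_profile_flat: "\<bar>v\<bar> \<le> 3/5 \<Longrightarrow> wide_profile v = 0"
  by (simp add: wide_profile_def ramp_def)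

lemma wide_profile_middle: "3/5 \<le> \<bar>v\<bar> \<Longrightarrow> \<bar>v\<bar> \<le> 9/10 \<Longrightarrow> wide_profile v = - ((\<bar>v\<bar> - 3/5)^2)"
  by (simp add: wide_profile_def ramp_def)

lemma wide_profile_outer: "9/10 \<le> \<bar>v\<bar> \<Longrightarrow> wide_profile v = 63/100 - 4/5 * \<bar>v\<bar>"
  by (simp add: wide_profile_def ramp_def power2_eq_square field_simps)

lemma wide_profile_nonpos: "wide_profile v \<le> 0"
  by (cases "\<bar>v\<bar> \<le> 3/5"; cases "\<bar>v\<bar> \<le> 9/10")
     (auto simp: wide_profile_flat wide_profile_middle wide_profile_outer)

lemma wide_profile_le_line: "wide_profile v \<le> 63/100 - 4/5 * \<bar>v\<bar>"
proof -
  consider "\<bar>v\<bar> \<le> 3/5" | "3/5 \<le> \<bar>v\<bar>" "\<bar>v\<bar> \<le> 9/10" | "9/10 \<le> \<bar>v\<bar>" by linarith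
  then show ?thesis
  proof cases
    case 2
    have "0 \<le> (9/10 - \<bar>v\<bar>) * (11/10 - \<bar>v\<bar>)" using 2 by simp
    then show ?thesis using 2 by (simp add: wide_profile_middle power2_eq_square field_simps)
  qed (simp_all add: wide_profile_flat wide_profile_outer)
qed

lemma wide_profile_le_parabola:
  "3/5 \<le> \<bar>v\<bar> \<Longrightarrow> \<bar>v\<bar> \<le> 11/10 \<Longrightarrow> wide_profile v \<le> - ((\<bar>v\<bar> - 3/5)^2)"
proof (cases "\<bar>v\<bar> \<le> 9/10")
  case False
  assume "\<bar>v\<bar> \<le> 11/10"
  with False have "0 \<le> (\<bar>v\<bar> - 9/10) * (11/10 - \<bar>v\<bar>)" by simp
  then show ?thesis using False by (simp add: wide_profile_outer power2_eq_square field_simps)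
qed (simp add: wide_profile_middle)

text \<open>
  The key inequality for queens on two wide diagonals. The bound $0.4898$ is attained on the axis at
  $(4/5, 0)$, and it is nearly attained on large parts of the board, so the cases follow the
  linear and quadratic pieces closely.
\<close>

lemma profiles_le_ordered:
  assumes y: "0 \<le> y" and yx: "y \<le> x" and x: "x \<le> 1"
  shows "col_profile x + col_profile y + wide_profile (x - y) + wide_profile (x + y) \<le> 2449/5000"
proof (cases "y \<ge> 27/100")
  case True
  have s: "col_profile x + col_profile y = 4/5 * (x + y) - 351/2500"
    using True yx by (simp add: col_profile_outer)
  have "4/5 * (x + y) + wide_profile (x + y) \<le> 63/100"
    using wide_profile_le_line[of "x + y"] True yx by (simp add: field_simps)
  then show ?thesis using s wide_profile_nonpos[of "x - y"] by linarith
next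
  case yin: False
  show ?thesis
  proof (cases "x \<le> 27/100")
    case True
    have "x^2 \<le> (27/100)^2" "y^2 \<le> (27/100)^2" using True y yx by (auto intro!: power_mono)
    then show ?thesis
      using col_profile_le_square[of x] col_profile_le_square[of y]
        wide_profile_nonpos[of "x - y"] wide_profile_nonpos[of "x + y"]
      by (simp add: power2_eq_square)
  next
    case xout: False
    have s: "col_profile x + col_profile y = 4/5 * x - 351/5000 + 2 * y^2"
      using y yx yin xout by (simp add: col_profile_outer col_profile_inner)
    consider (flat_low) "x - y \<le> 3/5" "x + y \<le> 3/5"
      | (flat_mid) "x - y \<le> 3/5" "3/5 \<le> x + y" "x + y \<le> 9/10"
      | (flat_high) "x - y \<le> 3/5" "9/10 \<le> x + y"
      | (mid_mid) "3/5 \<le> x - y" "x + y \<le> 11/10"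
      | (mid_high) "3/5 \<le> x - y" "11/10 \<le> x + y" by linarith
    then show ?thesis
    proof cases
      case flat_low
      have "2 * (y * y) \<le> 2 * (27/100 * y)" using y yin by (intro mult_left_mono mult_right_mono) auto
      then show ?thesis using s flat_low y yin wide_profile_nonpos[of "x - y"] wide_profile_nonpos[of "x + y"]
        by (simp add: power2_eq_square)
    next
      case flat_mid
      have "wide_profile (x + y) \<le> - ((x + y - 3/5)^2)"
        using wide_profile_le_parabola[of "x + y"] flat_mid by simp
      moreover have "4/5 * x - 351/5000 + 2 * y^2 - (x + y - 3/5)^2 \<le> 2449/5000"
      proof -
        (* The left-hand side increases with x here, so the worst point of the region lies on
           x - y = 3/5 for small y and on x + y = 9/10 for larger y. *)
        have low: "?thesis" if "y \<le> 15/100"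
        proof -
          have "0 \<le> (3/5 + y - x) * (7/5 - x - 3*y)" using flat_mid y that
            by (intro mult_nonneg_nonneg) auto
          moreover have "0 \<le> (y - 1/5)^2" by simp
          ultimately show ?thesis by (simp add: power2_eq_square field_simps)
        qed
        have high: "?thesis" if "15/100 \<le> y"
        proof -
          have "0 \<le> (9/10 - x - y) * (11/10 - x - y)" using flat_mid
            by (intro mult_nonneg_nonneg) auto
          moreover have "0 \<le> (y - 15/100) * (27/100 - y)" using that yin by simp
          ultimately show ?thesis using that yin by (simp add: power2_eq_square field_simps)
        qed
        show ?thesis using low high by linarith
      qed
      ultimately show ?thesis using s wide_profile_nonpos[of "x - y"] by linarith
    next
      case flat_high
      have "wide_profile (x + y) \<le> 63/100 - 4/5 * (x + y)"
        using wide_profile_le_line[of "x + y"] flat_high by simp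
      moreover have "0 \<le> (y - 15/100) * (27/100 - y)" using flat_high yin by simp
      ultimately show ?thesis using s wide_profile_nonpos[of "x - y"] flat_high yin
        by (simp add: power2_eq_square field_simps)
    next
      case mid_mid
      have "wide_profile (x + y) \<le> - ((x + y - 3/5)^2)" "wide_profile (x - y) \<le> - ((x - y - 3/5)^2)"
        using wide_profile_le_parabola[of "x + y"] wide_profile_le_parabola[of "x - y"] mid_mid y x by auto
      moreover have "0 \<le> (x - 4/5)^2" by simp
      ultimately show ?thesis using s by (simp add: power2_eq_square field_simps)
    next
      case mid_high
      have 1: "wide_profile (x + y) \<le> 63/100 - 4/5 * (x + y)"
        using wide_profile_le_line[of "x + y"] mid_high by simp
      have 2: "wide_profile (x - y) \<le> - ((x - y - 3/5)^2)"
        using wide_profile_le_parabola[of "x - y"] mid_high y x by auto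
      show ?thesis
      proof (cases "y \<le> 15/100")
        case True
        (* On this region x - y >= 11/10 - 2 y. *)
        have "(1/2 - 2 * y)^2 \<le> (x - y - 3/5)^2" using mid_high True by (intro power_mono) auto
        moreover have "0 \<le> (y - 3/10)^2" by simp
        ultimately have "2 * y^2 - 4/5 * y + 7/100 \<le> (x - y - 3/5)^2"
          by (simp add: power2_eq_square field_simps)
        then show ?thesis using s 1 2 by (simp add: field_simps)
      next
        case False
        have "0 \<le> (y - 15/100) * (27/100 - y)" using False yin by simp
        then show ?thesis using s 1 2 yin zero_le_power2[of "x - y - 3/5"]
          by (simp add: power2_eq_square field_simps)
      qed
    qed
  qed
qed

lemma profiles_le:
  assumes "\<bar>x\<bar> \<le> 1" and "\<bar>y\<bar> \<le> 1"
  shows "col_profile x + col_profile y + wide_profile (y - x) + wide_profile (x + y) \<le> 2449/5000"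
proof -
  have c: "col_profile z = col_profile \<bar>z\<bar>" and w: "wide_profile z = wide_profile \<bar>z\<bar>" for z
    by (simp_all add: col_profile_def wide_profile_def)
  define a b where "a = max \<bar>x\<bar> \<bar>y\<bar>" and "b = min \<bar>x\<bar> \<bar>y\<bar>"
  have "wide_profile \<bar>y - x\<bar> + wide_profile \<bar>x + y\<bar> = wide_profile (a - b) + wide_profile (a + b)"
  proof -
    have "\<bar>y - x\<bar> = a - b \<and> \<bar>x + y\<bar> = a + b \<or> \<bar>y - x\<bar> = a + b \<and> \<bar>x + y\<bar> = a - b"
      unfolding a_def b_def by (auto simp: abs_if max_def min_def)
    then show ?thesis by auto
  qed
  moreover have "col_profile \<bar>x\<bar> + col_profile \<bar>y\<bar> = col_profile a + col_profile b"
    unfolding a_def b_def by (simp add: max_def min_def)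
  moreover have "col_profile a + col_profile b + wide_profile (a - b) + wide_profile (a + b) \<le> 2449/5000"
    using assms by (intro profiles_le_ordered) (auto simp: a_def b_def)
  ultimately show ?thesis using c[of x] c[of y] w[of "y - x"] w[of "x + y"] by linarith
qed

text \<open>
  Adding the parallelogram term $-\frac{11}{10} x^2$, $\frac{11}{20} v^2$ leaves the total over a
  square unchanged; it is chosen so that all weights become nonnegative where they are
  used. The constants split the slack so that two wide, two core, or one wide and one
  core diagonal all satisfy the bound 1.
\<close>

definition col_weight :: "real \<Rightarrow> real" where
  "col_weight x = 3/100 + 3/2 * col_profile x - 11/10 * x^2"

definition wide_weight :: "real \<Rightarrow> real" where
  "wide_weight v = 2053/20000 + 3/2 * wide_profile v + 11/20 * v^2"

definition core_weight :: "real \<Rightarrow> real" where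
  "core_weight v = 47/100 - 19/20 * v^2"

lemma parallelogram: "(y - x)^2 + (x + y)^2 = 2 * x^2 + 2 * (y::real)^2"
  by (simp add: power2_eq_square algebra_simps)

lemma col_wide_weight_le:
  assumes "\<bar>x\<bar> \<le> 1" and "\<bar>y\<bar> \<le> 1"
  shows "col_weight x + col_weight y + wide_weight (y - x) + wide_weight (x + y) \<le> 1"
  using profiles_le[OF assms] parallelogram[of y x]
  unfolding col_weight_def wide_weight_def by linarith

lemma col_core_weight_le:
  "col_weight x + col_weight y + core_weight (y - x) + core_weight (x + y) \<le> 1"
  using col_profile_le_square[of x] col_profile_le_square[of y] parallelogram[of y x]
  unfolding col_weight_def core_weight_def by linarith

lemma col_weight_bounds:
  assumes "\<bar>x\<bar> \<le> 1"
  shows "0 \<le> col_weight x" and "col_weight x \<le> 53/200"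
proof -
  have sq: "x^2 = \<bar>x\<bar>^2" by simp
  have "0 \<le> col_weight x \<and> col_weight x \<le> 53/200"
  proof (cases "\<bar>x\<bar> \<le> 27/100")
    case True
    have "x^2 \<le> (27/100)^2" unfolding sq using True by (intro power_mono) auto
    then show ?thesis using True unfolding col_weight_def
      by (simp add: col_profile_inner power_divide)
  next
    case False
    define r where "r = \<bar>x\<bar>"
    have r: "27/100 \<le> r" "r \<le> 1" using False assms by (auto simp: r_def)
    then have "0 \<le> (1 - r) * (r - 27/100)" by simp
    then have "r^2 \<le> 127/100 * r - 27/100" by (simp add: power2_eq_square field_simps)
    moreover have "12/11 * r - 36/121 \<le> r^2"
      using zero_le_power2[of "r - 6/11"] by (simp add: power2_eq_square field_simps)
    moreover have "col_weight x = 3/100 + 3/2 * (4/5 * r - 351/5000) - 11/10 * r^2"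
      using r unfolding col_weight_def sq by (simp add: col_profile_outer r_def)
    ultimately show ?thesis using r by (auto simp: algebra_simps)
  qed
  then show "0 \<le> col_weight x" "col_weight x \<le> 53/200" by auto
qed

lemma wide_weight_nonneg: "0 \<le> wide_weight v"
proof -
  have sq: "v^2 = \<bar>v\<bar>^2" by simp
  consider "\<bar>v\<bar> \<le> 3/5" | "3/5 \<le> \<bar>v\<bar>" "\<bar>v\<bar> \<le> 9/10" | "9/10 \<le> \<bar>v\<bar>" by linarith
  then show ?thesis
  proof cases
    case 1
    then show ?thesis unfolding wide_weight_def by (simp add: wide_profile_flat)
  next
    case 2
    have "(\<bar>v\<bar> - 3/5)^2 \<le> (3/10)^2" using 2 by (intro power_mono) auto
    moreover have "(3/5)^2 \<le> v^2" unfolding sq using 2 by (intro power_mono) auto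
    ultimately show ?thesis using 2 unfolding wide_weight_def
      by (simp add: wide_profile_middle power_divide)
  next
    case 3
    have "11/20 * \<bar>v\<bar>^2 - 6/5 * \<bar>v\<bar> + 36/55 = 11/20 * (\<bar>v\<bar> - 12/11)^2"
      by (simp add: power2_eq_square field_simps)
    moreover have "0 \<le> 11/20 * (\<bar>v\<bar> - 12/11)^2" by simp
    ultimately have "0 \<le> 11/20 * v^2 - 6/5 * \<bar>v\<bar> + 36/55" unfolding sq by linarith
    then show ?thesis using 3 unfolding wide_weight_def
      by (simp add: wide_profile_outer algebra_simps)
  qed
qed

text \<open>
  With \<open>core_weight \<le> 47/100\<close> this bounds the weight of a wide and a core diagonal through one
  square by 1. The range contains all required wide diagonals once $(N - e)/N$ and $(N - f)/N$ are
  at most $317/400$.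
\<close>

lemma wide_weight_le:
  assumes "\<bar>v\<bar> \<le> 317/200"
  shows "wide_weight v \<le> 53/100"
proof -
  have sq: "v^2 = \<bar>v\<bar>^2" by simp
  define r where "r = \<bar>v\<bar>"
  consider "\<bar>v\<bar> \<le> 3/5" | "3/5 \<le> \<bar>v\<bar>" "\<bar>v\<bar> \<le> 9/10" | "9/10 \<le> \<bar>v\<bar>" by linarith
  then show ?thesis
  proof cases
    case 1
    have "v^2 \<le> (3/5)^2" unfolding sq using 1 by (intro power_mono) auto
    then show ?thesis using 1 unfolding wide_weight_def by (simp add: wide_profile_flat power_divide)
  next
    case 2
    have "36/19 * r - 324/361 \<le> r^2"
      using zero_le_power2[of "r - 18/19"] by (simp add: power2_eq_square field_simps)
    moreover have "wide_profile v = 6/5 * r - 9/25 - r^2"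
      using 2 by (simp add: wide_profile_middle r_def power2_eq_square field_simps)
    ultimately show ?thesis unfolding wide_weight_def sq r_def[symmetric] by (simp add: algebra_simps)
  next
    case 3
    have r: "9/10 \<le> r" "r \<le> 317/200" using 3 assms by (auto simp: r_def)
    then have "0 \<le> (r - 9/10) * (317/200 - r)" by simp
    then have "r^2 \<le> 497/200 * r - 2853/2000" by (simp add: power2_eq_square field_simps)
    then show ?thesis using r unfolding wide_weight_def sq wide_profile_outer[OF 3] r_def[symmetric] by (simp add: algebra_simps)
  qed
qed

lemma core_weight_bounds:
  shows "core_weight v \<le> 47/100" and "\<bar>v\<bar> \<le> 1/2 \<Longrightarrow> 0 \<le> core_weight v"
proof -
  show "core_weight v \<le> 47/100" by (simp add: core_weight_def)
  assume "\<bar>v\<bar> \<le> 1/2"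
  then have "\<bar>v\<bar>^2 \<le> (1/2)^2" by (intro power_mono) auto
  then show "0 \<le> core_weight v" by (simp add: core_weight_def power2_eq_square)
qed

section \<open>Sums over centred arithmetic progressions\<close>

text \<open>
  The progression $-(X-1), -(X-3), \dots, X-1$ with $X$ members. The required columns are
  \<open>centered_ap N\<close>, and the wide and core diagonals have index $2m$ with $m$ in such a progression.
\<close>

definition centered_ap :: "nat \<Rightarrow> int set" where
  "centered_ap X = {m. \<bar>m\<bar> < int X \<and> odd (m + int X)}"

lemma finite_centered_ap [simp]: "finite (centered_ap X)"
  by (rule finite_subset[of _ "{- int X..int X}"]) (auto simp: centered_ap_def)

lemma centered_ap_0 [simp]: "centered_ap 0 = {}"
  by (auto simp: centered_ap_def)

lemma centered_ap_1 [simp]: "centered_ap (Suc 0) = {0}"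
  by (auto simp: centered_ap_def)

lemma sum_centered_ap_step:
  fixes \<phi> :: "int \<Rightarrow> real"
  assumes even: "\<And>m. \<phi> (- m) = \<phi> m"
  shows "sum \<phi> (centered_ap (Suc (Suc X))) = sum \<phi> (centered_ap X) + 2 * \<phi> (int X + 1)"
proof -
  have "centered_ap (Suc (Suc X)) = insert (int X + 1) (insert (- (int X + 1)) (centered_ap X))"
  proof (rule set_eqI)
    fix m
    show "m \<in> centered_ap (Suc (Suc X)) \<longleftrightarrow> m \<in> insert (int X + 1) (insert (- (int X + 1)) (centered_ap X))"
      unfolding centered_ap_def insert_iff mem_Collect_eq of_nat_Suc by presburger
  qed
  moreover have "int X + 1 \<notin> insert (- (int X + 1)) (centered_ap X)" "- (int X + 1) \<notin> centered_ap X"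
    by (auto simp: centered_ap_def)
  ultimately show ?thesis using even[of "int X + 1"] by simp
qed

text \<open>
  Comparison of a sum with an antiderivative $A$: a step from $X$ to $X + 2$ adds the two terms at
  $\pm(X + 1)$, so it suffices to bound twice that term by the increment of $A$.
\<close>

lemma sum_centered_ap_le:
  fixes \<phi> :: "int \<Rightarrow> real" and A :: "real \<Rightarrow> real"
  assumes even: "\<And>m. \<phi> (- m) = \<phi> m"
    and start: "0 \<le> A 0" "\<phi> 0 \<le> A 1"
    and step: "\<And>m::nat. 2 * \<phi> (int m + 1) \<le> A (real m + 2) - A (real m)"
  shows "sum \<phi> (centered_ap X) \<le> A (real X)"
proof (induction X rule: induct_nat_012)
  case (ge2 X)
  have "sum \<phi> (centered_ap (Suc (Suc X))) = sum \<phi> (centered_ap X) + 2 * \<phi> (int X + 1)"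
    by (rule sum_centered_ap_step) (rule even)
  then show ?case using ge2 step[of X] by (simp add: algebra_simps)
qed (use start in auto)

lemma sum_centered_ap_const: "(\<Sum>m\<in>centered_ap X. c) = c * real X"
proof (induction X rule: induct_nat_012)
  case (ge2 X)
  then show ?case using sum_centered_ap_step[of "\<lambda>_. c" X] by (simp add: algebra_simps)
qed auto

lemma card_centered_ap [simp]: "card (centered_ap X) = X"
  using sum_centered_ap_const[of 1 X] by simp

lemma sum_centered_ap_square:
  "(\<Sum>m\<in>centered_ap X. (real_of_int m)^2) = (real X ^ 3 - real X) / 3"
proof (induction X rule: induct_nat_012)
  case (ge2 X)
  then show ?case using sum_centered_ap_step[of "\<lambda>m. (real_of_int m)^2" X]
    by (simp add: power2_eq_square power3_eq_cube field_simps)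
qed auto

lemma ramp_cases: "x \<le> 0 \<Longrightarrow> ramp x = 0" "0 \<le> x \<Longrightarrow> ramp x = x"
  by (auto simp: ramp_def)

text \<open>
  Midpoint rule on intervals of length 2. Ramps and their squares are convex, so the midpoint value is
  at most the mean; for the square the error is also bounded from above.
\<close>

lemma ramp_midpoint: "4 * ramp x \<le> (ramp (x + 1))^2 - (ramp (x - 1))^2"
proof -
  have "0 \<le> (x - 1)^2" "0 \<le> (x + 1)^2" by simp_all
  then show ?thesis
    by (auto simp: ramp_def max_def power2_eq_square algebra_simps)
qed

lemma ramp_square_midpoint:
  "6 * (ramp x)^2 \<le> (ramp (x + 1))^3 - (ramp (x - 1))^3"
  "(ramp (x + 1))^3 - (ramp (x - 1))^3 \<le> 6 * (ramp x)^2 + 2"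
proof -
  consider "x \<le> -1" | "-1 \<le> x" "x \<le> 0" | "0 \<le> x" "x \<le> 1" | "1 \<le> x" by linarith
  then have "6 * (ramp x)^2 \<le> (ramp (x + 1))^3 - (ramp (x - 1))^3 \<and>
    (ramp (x + 1))^3 - (ramp (x - 1))^3 \<le> 6 * (ramp x)^2 + 2"
  proof cases
    case 2
    have "(x + 1)^3 \<le> 1^3" using 2 by (intro power_mono) auto
    then show ?thesis using 2 by (simp add: ramp_cases)
  next
    case 3
    have "(1 - x)^3 \<le> 1^3" "0 \<le> (1 - x)^3" using 3 by (intro power_mono zero_le_power; simp)+
    then show ?thesis using 3 by (simp add: ramp_cases power2_eq_square power3_eq_cube algebra_simps)
  qed (simp_all add: ramp_cases power2_eq_square power3_eq_cube algebra_simps)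
  then show "6 * (ramp x)^2 \<le> (ramp (x + 1))^3 - (ramp (x - 1))^3"
    "(ramp (x + 1))^3 - (ramp (x - 1))^3 \<le> 6 * (ramp x)^2 + 2" by auto
qed

lemma sum_ramp_le:
  assumes "0 \<le> c"
  shows "(\<Sum>m\<in>centered_ap X. ramp (\<bar>real_of_int m\<bar> - c)) \<le> (ramp (real X - c))^2 / 2"
proof (rule sum_centered_ap_le[where A = "\<lambda>x. (ramp (x - c))^2 / 2"])
  show "2 * ramp (\<bar>real_of_int (int m + 1)\<bar> - c) \<le> (ramp (real m + 2 - c))^2 / 2 - (ramp (real m - c))^2 / 2" for m
    using ramp_midpoint[of "real m + 1 - c"] by (simp add: algebra_simps)
qed (use assms in \<open>auto simp: ramp_cases\<close>)

lemma sum_ramp_square_le: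
  assumes "0 \<le> c"
  shows "(\<Sum>m\<in>centered_ap X. (ramp (\<bar>real_of_int m\<bar> - c))^2) \<le> (ramp (real X - c))^3 / 3"
proof (rule sum_centered_ap_le[where A = "\<lambda>x. (ramp (x - c))^3 / 3"])
  show "2 * (ramp (\<bar>real_of_int (int m + 1)\<bar> - c))^2 \<le> (ramp (real m + 2 - c))^3 / 3 - (ramp (real m - c))^3 / 3" for m
    using ramp_square_midpoint(1)[of "real m + 1 - c"] by (simp add: algebra_simps)
qed (use assms in \<open>auto simp: ramp_cases ramp_def\<close>)

lemma sum_ramp_square_ge:
  assumes "0 \<le> c"
  shows "(ramp (real X - c))^3 / 3 - real X / 3 \<le> (\<Sum>m\<in>centered_ap X. (ramp (\<bar>real_of_int m\<bar> - c))^2)"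
proof -
  have "(\<Sum>m\<in>centered_ap X. - ((ramp (\<bar>real_of_int m\<bar> - c))^2)) \<le> real X / 3 - (ramp (real X - c))^3 / 3"
  proof (rule sum_centered_ap_le[where A = "\<lambda>x. x / 3 - (ramp (x - c))^3 / 3"])
    show "2 * - ((ramp (\<bar>real_of_int (int m + 1)\<bar> - c))^2) \<le>
      (real m + 2) / 3 - (ramp (real m + 2 - c))^3 / 3 - (real m / 3 - (ramp (real m - c))^3 / 3)" for m
      using ramp_square_midpoint(2)[of "real m + 1 - c"] by (simp add: field_simps)
    have "(ramp (1 - c))^3 \<le> 1^3" using assms by (intro power_mono) (auto simp: ramp_def)
    then show "- ((ramp (\<bar>real_of_int 0\<bar> - c))^2) \<le> 1 / 3 - (ramp (1 - c))^3 / 3"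
      using assms by (simp add: ramp_cases)
  qed (use assms in \<open>auto simp: ramp_cases\<close>)
  then show ?thesis by (simp add: sum_negf)
qed

lemma centered_ap_iff: "m \<in> centered_ap X \<longleftrightarrow> \<bar>m\<bar> < int X \<and> odd (m + int X)"
  by (simp add: centered_ap_def)

definition even_lines :: "nat \<Rightarrow> int set" where
  "even_lines X = (\<lambda>m. 2 * m) ` centered_ap X"

lemma even_lines_iff: "v \<in> even_lines X \<longleftrightarrow> even v \<and> v div 2 \<in> centered_ap X"
  by (auto simp: even_lines_def elim!: evenE)

lemma sum_even_lines: "sum g (even_lines X) = (\<Sum>m\<in>centered_ap X. g (2 * m))"
  unfolding even_lines_def by (subst sum.reindex) (auto simp: inj_on_def)

section \<open>Totals of the weight functions\<close>

lemma ramp_scale: "0 < c \<Longrightarrow> ramp (x / c) = ramp x / c"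
  by (simp add: ramp_def max_def field_simps)

lemma sum_col_weight_ge:
  assumes "0 < N"
  shows "1624/10000 * real N - 1 \<le> (\<Sum>m\<in>centered_ap N. col_weight (real_of_int m / real N))"
proof -
  define n where "n = real N"
  have n: "1 \<le> n" using assms by (simp add: n_def)
  define c where "c = 27/100 * n"
  have w: "col_weight (real_of_int m / n) = 3/100 + 19/10 / n^2 * (real_of_int m)^2
      - 3 / n^2 * (ramp (\<bar>real_of_int m\<bar> - c))^2 - 21/50 / n * ramp (\<bar>real_of_int m\<bar> - c)" for m
  proof -
    have "\<bar>real_of_int m / n\<bar> - 27/100 = (\<bar>real_of_int m\<bar> - c) / n"
      using n by (simp add: c_def abs_divide field_simps)
    then have "ramp (\<bar>real_of_int m / n\<bar> - 27/100) = ramp (\<bar>real_of_int m\<bar> - c) / n"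
      using n by (simp add: ramp_scale)
    then show ?thesis unfolding col_weight_def col_profile_def
      by (simp add: power_divide algebra_simps)
  qed
  have c0: "0 \<le> c" and nc: "ramp (n - c) = 73/100 * n" using n by (simp_all add: ramp_def c_def)
  define P Q R where "P = 3 / n^2 * (\<Sum>m\<in>centered_ap N. (ramp (\<bar>real_of_int m\<bar> - c))^2)"
    and "Q = 21/50 / n * (\<Sum>m\<in>centered_ap N. ramp (\<bar>real_of_int m\<bar> - c))"
    and "R = 19/10 / n^2 * ((n^3 - n) / 3)"
  have "(\<Sum>m\<in>centered_ap N. col_weight (real_of_int m / n)) = 3/100 * n + R - P - Q"
    by (simp only: w P_def Q_def R_def sum.distrib sum_subtractf sum_distrib_left[symmetric]
        sum_centered_ap_const sum_centered_ap_square n_def[symmetric])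
  moreover have "P \<le> 389017/1000000 * n"
  proof -
    have "P \<le> 3 / n^2 * ((73/100 * n)^3 / 3)"
      unfolding P_def using sum_ramp_square_le[OF c0, of N] unfolding n_def[symmetric] nc
      by (intro mult_left_mono) auto
    also have "\<dots> = 389017/1000000 * n"
      using n by (simp add: field_simps power2_eq_square power3_eq_cube)
    finally show ?thesis .
  qed
  moreover have "Q \<le> 111909/1000000 * n"
  proof -
    have "Q \<le> 21/50 / n * ((73/100 * n)^2 / 2)"
      unfolding Q_def using sum_ramp_le[OF c0, of N] n unfolding n_def[symmetric] nc
      by (intro mult_left_mono) auto
    also have "\<dots> = 111909/1000000 * n"
      using n by (simp add: field_simps power2_eq_square)
    finally show ?thesis .
  qed
  moreover have "R = 19/30 * n - 19/30 / n"
    using n unfolding R_def by (simp add: field_simps power2_eq_square power3_eq_cube)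
  moreover have "19/30 / n \<le> 1" using n by (simp add: field_simps)
  ultimately show ?thesis using n unfolding n_def[symmetric] by linarith
qed

text \<open>
  The integrals over $[0, \xi]$ and $[0, \eta]$ of $v \mapsto$ \<open>wide_weight (2 * v)\<close> and
  $v \mapsto$ \<open>core_weight (2 * v)\<close>, the former for $\xi \ge 9/20$. They are the limits of the total
  weight, divided by $N$, of $\xi N$ wide and $\eta N$ core diagonals.
\<close>

definition wide_mass :: "real \<Rightarrow> real" where
  "wide_mass \<xi> = 2053/20000 * \<xi> + 11/15 * \<xi>^3 - 2 * (\<xi> - 3/10)^3 + 2 * (\<xi> - 9/20)^3 - 3/10 * (\<xi> - 9/20)^2"

definition core_mass :: "real \<Rightarrow> real" where
  "core_mass \<eta> = 47/100 * \<eta> - 19/15 * \<eta>^3"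

lemma sum_wide_weight_ge:
  assumes "0 < N" and X: "X \<le> N" "9/20 * real N \<le> real X"
  shows "real N * wide_mass (real X / real N) - 3 \<le> (\<Sum>m\<in>centered_ap X. wide_weight (real_of_int (2 * m) / real N))"
proof -
  define n where "n = real N"
  have n: "1 \<le> n" using assms by (simp add: n_def)
  define x where "x = real X"
  have x: "x \<le> n" "9/20 * n \<le> x" "0 \<le> x" using X by (auto simp: n_def x_def)
  define c d where "c = 3/10 * n" and "d = 9/20 * n"
  have w: "wide_weight (real_of_int (2 * m) / n) = 2053/20000 + 11/5 / n^2 * (real_of_int m)^2
      - 6 / n^2 * (ramp (\<bar>real_of_int m\<bar> - c))^2 + 6 / n^2 * (ramp (\<bar>real_of_int m\<bar> - d))^2
      - 3/5 / n * ramp (\<bar>real_of_int m\<bar> - d)" for m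
  proof -
    have r: "ramp (\<bar>real_of_int (2 * m) / n\<bar> - k) = 2 * ramp (\<bar>real_of_int m\<bar> - k / 2 * n) / n" for k
    proof -
      have "\<bar>real_of_int (2 * m) / n\<bar> - k = (\<bar>real_of_int m\<bar> - k / 2 * n) / (n / 2)"
        using n by (simp add: abs_divide abs_mult field_simps)
      then have "ramp (\<bar>real_of_int (2 * m) / n\<bar> - k) = ramp (\<bar>real_of_int m\<bar> - k / 2 * n) / (n / 2)"
        using n by (simp only: ramp_scale)
      then show ?thesis by simp
    qed
    have "ramp (\<bar>real_of_int (2 * m) / n\<bar> - 3/5) = 2 * ramp (\<bar>real_of_int m\<bar> - c) / n"
      "ramp (\<bar>real_of_int (2 * m) / n\<bar> - 9/10) = 2 * ramp (\<bar>real_of_int m\<bar> - d) / n"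
      unfolding r c_def d_def by simp_all
    then show ?thesis unfolding wide_weight_def wide_profile_def
      by (simp add: power_divide power_mult_distrib algebra_simps)
  qed
  have rc: "ramp (x - c) = x - c" "ramp (x - d) = x - d"
    using n x by (auto simp: ramp_def c_def d_def)
  have "(\<Sum>m\<in>centered_ap X. wide_weight (real_of_int (2 * m) / n)) =
      2053/20000 * x + 11/5 / n^2 * ((x^3 - x) / 3)
      - 6 / n^2 * (\<Sum>m\<in>centered_ap X. (ramp (\<bar>real_of_int m\<bar> - c))^2)
      + 6 / n^2 * (\<Sum>m\<in>centered_ap X. (ramp (\<bar>real_of_int m\<bar> - d))^2)
      - 3/5 / n * (\<Sum>m\<in>centered_ap X. ramp (\<bar>real_of_int m\<bar> - d))"
    by (simp only: w sum.distrib sum_subtractf sum_distrib_left[symmetric]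
        sum_centered_ap_const sum_centered_ap_square x_def)
  moreover have "6 / n^2 * (\<Sum>m\<in>centered_ap X. (ramp (\<bar>real_of_int m\<bar> - c))^2) \<le> 6 / n^2 * ((x - c)^3 / 3)"
    using sum_ramp_square_le[of c X] n rc
    by (intro mult_left_mono) (auto simp: c_def x_def[symmetric])
  moreover have "6 / n^2 * ((x - d)^3 / 3 - x / 3) \<le> 6 / n^2 * (\<Sum>m\<in>centered_ap X. (ramp (\<bar>real_of_int m\<bar> - d))^2)"
    using sum_ramp_square_ge[of d X] n rc
    by (intro mult_left_mono) (auto simp: d_def x_def[symmetric])
  moreover have "3/5 / n * (\<Sum>m\<in>centered_ap X. ramp (\<bar>real_of_int m\<bar> - d)) \<le> 3/5 / n * ((x - d)^2 / 2)"
    using sum_ramp_le[of d X] n rc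
    by (intro mult_left_mono) (auto simp: d_def x_def[symmetric])
  moreover have "n * wide_mass (x / n) = 2053/20000 * x + 11/5 / n^2 * (x^3 / 3) - 6 / n^2 * ((x - c)^3 / 3)
      + 6 / n^2 * ((x - d)^3 / 3) - 3/5 / n * ((x - d)^2 / 2)"
  proof -
    have scaled: "x / n - 3/10 = (x - c) / n" "x / n - 9/20 = (x - d) / n"
      using n by (simp_all add: c_def d_def field_simps)
    have powers: "n * (k * (z / n)^3) = k / n^2 * z^3" "n * (k * (z / n)^2) = k / n * z^2" "n * (k * (z / n)) = k * z" for k z
      using n by (simp_all add: field_simps power2_eq_square power3_eq_cube)
    show ?thesis unfolding wide_mass_def scaled distrib_left right_diff_distrib powers by simp
  qed
  moreover have nn: "n \<le> n * n" using n by simp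
  then have "11/5 / n^2 * (x / 3) \<le> 1"
  proof -
    have "11/5 * (x / 3) \<le> n * n" using x nn by linarith
    then show ?thesis using n by (simp add: field_simps power2_eq_square)
  qed
  moreover have "6 / n^2 * (x / 3) \<le> 2"
  proof -
    have "6 * (x / 3) \<le> 2 * (n * n)" using x nn by linarith
    then show ?thesis using n by (simp add: field_simps power2_eq_square)
  qed
  ultimately show ?thesis unfolding n_def[symmetric] x_def[symmetric]
    by (simp add: diff_divide_distrib right_diff_distrib)
qed

lemma sum_core_weight_ge:
  assumes "0 < N"
  shows "real N * core_mass (real X / real N) \<le> (\<Sum>m\<in>centered_ap X. core_weight (real_of_int (2 * m) / real N))"
proof -
  have "(\<Sum>m\<in>centered_ap X. core_weight (real_of_int (2 * m) / real N)) =
      47/100 * real X - 19/5 / (real N)^2 * ((real X ^ 3 - real X) / 3)"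
    unfolding core_weight_def
    by (simp add: sum_subtractf sum_centered_ap_const power_divide power_mult_distrib
        sum_distrib_left[symmetric] sum_divide_distrib[symmetric] sum_centered_ap_square)
  moreover have "real N * core_mass (real X / real N) = 47/100 * real X - 19/5 / (real N)^2 * (real X ^ 3 / 3)"
    using assms unfolding core_mass_def by (simp add: field_simps power2_eq_square power3_eq_cube)
  moreover have "19/5 / (real N)^2 * ((real X ^ 3 - real X) / 3) \<le> 19/5 / (real N)^2 * (real X ^ 3 / 3)"
    by (intro mult_left_mono) auto
  ultimately show ?thesis by linarith
qed

text \<open>
  The first coefficient of the Taylor expansion at the left end $\xi = 0.788$ is positive
  and dominates, so the left end is the worst case.
\<close>

lemma mass_ge:
  assumes "197/250 \<le> \<xi>" "\<xi> \<le> 317/400"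
  shows "3378/10000 \<le> wide_mass \<xi> + core_mass (1 - \<xi>)"
proof -
  define s where "s = \<xi> - 197/250"
  have s: "0 \<le> s" "s \<le> 1/200" using assms by (auto simp: s_def)
  have \<xi>: "\<xi> = 197/250 + s" by (simp add: s_def)
  have "s * s \<le> 1/200 * s" using s by (intro mult_right_mono) auto
  moreover have "0 \<le> s * (s * s)" using s by simp
  moreover have "wide_mass \<xi> + core_mass (1 - \<xi>) = 126678479/375000000 + 111657/500000 * s - 34/125 * (s * s) + 2 * (s * (s * s))"
    unfolding \<xi> wide_mass_def core_mass_def by (simp add: power2_eq_square power3_eq_cube field_simps)
  ultimately show ?thesis using s by linarith
qed

section \<open>Weighted counting of queens\<close>

lemma real_square_le: "\<bar>m\<bar> \<le> int K \<Longrightarrow> (real_of_int m)^2 \<le> (real K)^2"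
  by (metis abs_le_square_iff abs_of_nat of_int_abs of_int_le_iff of_int_of_nat_eq)

definition weight_on :: "int set \<Rightarrow> (int \<Rightarrow> real) \<Rightarrow> int \<Rightarrow> real" where
  "weight_on I g m = (if m \<in> I then g m else 0)"

lemma sum_weight_le:
  fixes \<kappa> :: "'a \<Rightarrow> int"
  assumes "finite D" and sub: "I \<subseteq> \<kappa> ` D" and nonneg: "\<And>m. m \<in> I \<Longrightarrow> 0 \<le> g m"
  shows "sum g I \<le> (\<Sum>q\<in>D. weight_on I g (\<kappa> q))"
proof -
  have "\<kappa> ` {q\<in>D. \<kappa> q \<in> I} = I" using sub by auto
  then have "sum g I \<le> sum (g \<circ> \<kappa>) {q\<in>D. \<kappa> q \<in> I}"
    using sum_image_le[of "{q\<in>D. \<kappa> q \<in> I}" g \<kappa>] assms by simp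
  also have "\<dots> = (\<Sum>q\<in>D. weight_on I g (\<kappa> q))"
    using \<open>finite D\<close> by (simp add: sum.inter_filter weight_on_def)
  finally show ?thesis .
qed

text \<open>
  What a Type A cover supplies, reduced to the required lines. In terms of the parameters,
  $e + 2u + 1 = N - f$ and $f + 2u + 1 = N - e$, so the numbers of wide diagonals are
  expressed by $N$, $e$ and $f$ alone.
\<close>

locale queen_cover =
  fixes N e f :: nat and D :: "square set"
  assumes finite_D: "finite D"
    and square_bound: "\<And>x y. (x, y) \<in> D \<Longrightarrow> \<bar>x\<bar> \<le> int N \<and> \<bar>y\<bar> \<le> int N"
    and N_pos: "0 < N" and e_le: "e \<le> N" and f_le: "f \<le> N" and parity: "odd (e + f + N)"
    and columns: "centered_ap N \<subseteq> fst ` D"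
    and rows: "centered_ap N \<subseteq> snd ` D"
    and wide_diffs: "even_lines (N - f) \<subseteq> (\<lambda>(x, y). y - x) ` D"
    and core_diffs: "even_lines e \<subseteq> (\<lambda>(x, y). y - x) ` D"
    and wide_sums: "even_lines (N - e) \<subseteq> (\<lambda>(x, y). x + y) ` D"
    and core_sums: "even_lines f \<subseteq> (\<lambda>(x, y). x + y) ` D"
begin

text \<open>
  Weak duality: count each required line at some queen on it, and exchange the order of summation.
\<close>

lemma total_weight_le_card:
  assumes g: "\<And>m. m \<in> centered_ap N \<Longrightarrow> 0 \<le> g m"
    and a: "\<And>v. v \<in> even_lines (N - f) \<union> even_lines (N - e) \<Longrightarrow> 0 \<le> a v"
    and b: "\<And>v. v \<in> even_lines e \<union> even_lines f \<Longrightarrow> 0 \<le> b v"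
    and square: "\<And>x y. \<bar>x\<bar> \<le> int N \<Longrightarrow> \<bar>y\<bar> \<le> int N \<Longrightarrow>
      weight_on (centered_ap N) g x + weight_on (centered_ap N) g y
      + weight_on (even_lines (N - f)) a (y - x) + weight_on (even_lines e) b (y - x)
      + weight_on (even_lines (N - e)) a (x + y) + weight_on (even_lines f) b (x + y) \<le> 1"
  shows "2 * sum g (centered_ap N)
      + (\<Sum>m\<in>centered_ap (N - f). a (2 * m)) + (\<Sum>m\<in>centered_ap e. b (2 * m))
      + (\<Sum>m\<in>centered_ap (N - e). a (2 * m)) + (\<Sum>m\<in>centered_ap f. b (2 * m)) \<le> real (card D)"
proof -
  let ?w = "\<lambda>x y. weight_on (centered_ap N) g x + weight_on (centered_ap N) g y
      + weight_on (even_lines (N - f)) a (y - x) + weight_on (even_lines e) b (y - x)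
      + weight_on (even_lines (N - e)) a (x + y) + weight_on (even_lines f) b (x + y)"
  have "sum g (centered_ap N) \<le> (\<Sum>q\<in>D. weight_on (centered_ap N) g (fst q))"
    by (rule sum_weight_le[OF finite_D columns g])
  moreover have "sum g (centered_ap N) \<le> (\<Sum>q\<in>D. weight_on (centered_ap N) g (snd q))"
    by (rule sum_weight_le[OF finite_D rows g])
  moreover have "sum a (even_lines (N - f)) \<le> (\<Sum>q\<in>D. weight_on (even_lines (N - f)) a (case q of (x, y) \<Rightarrow> y - x))"
    by (rule sum_weight_le[OF finite_D wide_diffs]) (use a in auto)
  moreover have "sum b (even_lines e) \<le> (\<Sum>q\<in>D. weight_on (even_lines e) b (case q of (x, y) \<Rightarrow> y - x))"
    by (rule sum_weight_le[OF finite_D core_diffs]) (use b in auto)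
  moreover have "sum a (even_lines (N - e)) \<le> (\<Sum>q\<in>D. weight_on (even_lines (N - e)) a (case q of (x, y) \<Rightarrow> x + y))"
    by (rule sum_weight_le[OF finite_D wide_sums]) (use a in auto)
  moreover have "sum b (even_lines f) \<le> (\<Sum>q\<in>D. weight_on (even_lines f) b (case q of (x, y) \<Rightarrow> x + y))"
    by (rule sum_weight_le[OF finite_D core_sums]) (use b in auto)
  ultimately have "2 * sum g (centered_ap N)
      + sum a (even_lines (N - f)) + sum b (even_lines e)
      + sum a (even_lines (N - e)) + sum b (even_lines f) \<le> (\<Sum>q\<in>D. ?w (fst q) (snd q))"
    by (simp add: sum.distrib case_prod_unfold)
  also have "\<dots> \<le> (\<Sum>q\<in>D. 1)"
    by (intro sum_mono square) (use square_bound in force)+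
  finally show ?thesis by (simp add: sum_even_lines)
qed

lemma parity_classes_disjoint: "v \<in> even_lines (N - f) \<Longrightarrow> v \<notin> even_lines e"
  "v \<in> even_lines (N - e) \<Longrightarrow> v \<notin> even_lines f"
  using parity e_le f_le by (auto simp: even_lines_iff centered_ap_iff of_nat_diff)

lemma card_ge_diagonals: "N - f + e \<le> card D" "N - e + f \<le> card D"
proof -
  have c: "card (even_lines X) = X" "finite (even_lines X)" for X
    unfolding even_lines_def by (auto simp: card_image inj_on_def)
  have "card (even_lines (N - f) \<union> even_lines e) \<le> card ((\<lambda>(x, y). y - x) ` D)"
    using wide_diffs core_diffs finite_D by (intro card_mono) auto
  moreover have "card (even_lines (N - f) \<union> even_lines e) = N - f + e"
    using parity_classes_disjoint(1) c by (subst card_Un_disjoint) auto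
  ultimately show "N - f + e \<le> card D" using card_image_le[OF finite_D] le_trans by metis
  have "card (even_lines (N - e) \<union> even_lines f) \<le> card ((\<lambda>(x, y). x + y) ` D)"
    using wide_sums core_sums finite_D by (intro card_mono) auto
  moreover have "card (even_lines (N - e) \<union> even_lines f) = N - e + f"
    using parity_classes_disjoint(2) c by (subst card_Un_disjoint) auto
  ultimately show "N - e + f \<le> card D" using card_image_le[OF finite_D] le_trans by metis
qed

text \<open>
  Up to a factor and lower order terms, the sum of the squares of all required diagonal indices.
\<close>

abbreviation cubes :: real where
  "cubes \<equiv> real (N - f) ^ 3 + real e ^ 3 + real (N - e) ^ 3 + real f ^ 3"

text \<open>
  The weighting from the parallelogram law with column weight $x^2/(4N^2)$ and diagonal weight
  $\frac12 - v^2/(8N^2)$. The factor is the largest that keeps the latter nonnegative on the board.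
\<close>

lemma excess_ge_cubes_deficit: "(real N ^ 3 - cubes) / (6 * (real N)^2) \<le> real (card D) - real N"
proof -
  define g where "g m = (real_of_int m)^2 / (4 * (real N)^2)" for m
  define a where "a v = 1/2 - (real_of_int v)^2 / (8 * (real N)^2)" for v
  have g0: "0 \<le> g m" for m by (simp add: g_def)
  have a0: "0 \<le> a v" if "\<bar>v\<bar> \<le> int (2 * N)" for v
  proof -
    have "(real_of_int v)^2 \<le> (real (2 * N))^2" by (rule real_square_le[OF that])
    then show ?thesis using N_pos by (simp add: a_def field_simps power_mult_distrib)
  qed
  have bound: "\<bar>v\<bar> \<le> int (2 * N)" if "v \<in> even_lines X" "X \<le> N" for v X
    using that by (auto simp: even_lines_def centered_ap_iff)
  have "2 * sum g (centered_ap N)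
      + (\<Sum>m\<in>centered_ap (N - f). a (2 * m)) + (\<Sum>m\<in>centered_ap e. a (2 * m))
      + (\<Sum>m\<in>centered_ap (N - e). a (2 * m)) + (\<Sum>m\<in>centered_ap f. a (2 * m)) \<le> real (card D)"
  proof (rule total_weight_le_card)
    fix x y :: int assume xy: "\<bar>x\<bar> \<le> int N" "\<bar>y\<bar> \<le> int N"
    have "weight_on (even_lines (N - f)) a (y - x) + weight_on (even_lines e) a (y - x) \<le> a (y - x)"
      "weight_on (even_lines (N - e)) a (x + y) + weight_on (even_lines f) a (x + y) \<le> a (x + y)"
      using a0[of "y - x"] a0[of "x + y"] xy parity_classes_disjoint by (auto simp: weight_on_def)
    moreover have "weight_on (centered_ap N) g x \<le> g x" "weight_on (centered_ap N) g y \<le> g y"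
      using g0 by (auto simp: weight_on_def)
    moreover have "g x + g y + a (y - x) + a (x + y) = 1"
    proof -
      have "a (y - x) + a (x + y) = 1 - ((real_of_int y - real_of_int x)^2 + (real_of_int x + real_of_int y)^2) / (8 * (real N)^2)"
        unfolding a_def by (simp add: add_divide_distrib)
      then show ?thesis unfolding parallelogram g_def by (simp add: add_divide_distrib)
    qed
    ultimately show "weight_on (centered_ap N) g x + weight_on (centered_ap N) g y
      + weight_on (even_lines (N - f)) a (y - x) + weight_on (even_lines e) a (y - x)
      + weight_on (even_lines (N - e)) a (x + y) + weight_on (even_lines f) a (x + y) \<le> 1" by linarith
  qed (use g0 a0 bound e_le f_le in auto)
  note total = this
  define k where "k = 1 / (6 * (real N)^2)"
  have sum_g: "sum g (centered_ap N) = (real N ^ 3 - real N) * k / 2"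
    unfolding g_def k_def by (simp add: sum_divide_distrib[symmetric] sum_centered_ap_square)
  have sum_a: "(\<Sum>m\<in>centered_ap X. a (2 * m)) = real X / 2 - (real X ^ 3 - real X) * k" for X
    unfolding a_def k_def using N_pos
    by (simp add: sum_subtractf sum_centered_ap_const sum_divide_distrib[symmetric]
        power_mult_distrib sum_distrib_left[symmetric] sum_centered_ap_square field_simps)
  have "real N + (real N ^ 3 - cubes + real N) * k \<le> real (card D)"
    using total e_le f_le unfolding sum_g sum_a by (simp add: field_simps of_nat_diff)
  moreover have "0 \<le> real N * k" by (simp add: k_def)
  ultimately have "(real N ^ 3 - cubes) * k \<le> real (card D) - real N"
    by (simp add: algebra_simps)
  then show ?thesis by (simp add: k_def)
qed

text \<open>
  The same with the opposite sign: column weight $\frac12 - x^2/(2N^2)$ and diagonal weight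
  $v^2/(4N^2)$.
\<close>

lemma excess_ge_cubes_surplus: "(cubes - real N ^ 3 - real N) / (3 * (real N)^2) \<le> real (card D) - real N"
proof -
  define g where "g m = 1/2 - (real_of_int m)^2 / (2 * (real N)^2)" for m
  define a where "a v = (real_of_int v)^2 / (4 * (real N)^2)" for v
  have a0: "0 \<le> a v" for v by (simp add: a_def)
  have g0: "0 \<le> g m" if "\<bar>m\<bar> \<le> int N" for m
  proof -
    have "(real_of_int m)^2 \<le> (real N)^2" by (rule real_square_le[OF that])
    then show ?thesis using N_pos by (simp add: g_def field_simps)
  qed
  have "2 * sum g (centered_ap N)
      + (\<Sum>m\<in>centered_ap (N - f). a (2 * m)) + (\<Sum>m\<in>centered_ap e. a (2 * m))
      + (\<Sum>m\<in>centered_ap (N - e). a (2 * m)) + (\<Sum>m\<in>centered_ap f. a (2 * m)) \<le> real (card D)"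
  proof (rule total_weight_le_card)
    fix x y :: int assume xy: "\<bar>x\<bar> \<le> int N" "\<bar>y\<bar> \<le> int N"
    have "weight_on (even_lines (N - f)) a (y - x) + weight_on (even_lines e) a (y - x) \<le> a (y - x)"
      "weight_on (even_lines (N - e)) a (x + y) + weight_on (even_lines f) a (x + y) \<le> a (x + y)"
      using a0 parity_classes_disjoint by (auto simp: weight_on_def)
    moreover have "weight_on (centered_ap N) g x \<le> g x" "weight_on (centered_ap N) g y \<le> g y"
      using g0 xy by (auto simp: weight_on_def)
    moreover have "g x + g y + a (y - x) + a (x + y) = 1"
    proof -
      have "a (y - x) + a (x + y) = ((real_of_int y - real_of_int x)^2 + (real_of_int x + real_of_int y)^2) / (4 * (real N)^2)"
        unfolding a_def by (simp add: add_divide_distrib)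
      then show ?thesis unfolding parallelogram g_def by (simp add: add_divide_distrib)
    qed
    ultimately show "weight_on (centered_ap N) g x + weight_on (centered_ap N) g y
      + weight_on (even_lines (N - f)) a (y - x) + weight_on (even_lines e) a (y - x)
      + weight_on (even_lines (N - e)) a (x + y) + weight_on (even_lines f) a (x + y) \<le> 1" by linarith
  qed (use g0 a0 in \<open>auto simp: centered_ap_iff\<close>)
  note total = this
  define k where "k = 1 / (3 * (real N)^2)"
  have sum_g: "sum g (centered_ap N) = real N / 2 - (real N ^ 3 - real N) * k / 2"
    unfolding g_def k_def
    by (simp add: sum_subtractf sum_centered_ap_const sum_divide_distrib[symmetric] sum_centered_ap_square)
  have sum_a: "(\<Sum>m\<in>centered_ap X. a (2 * m)) = (real X ^ 3 - real X) * k" for X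
    unfolding a_def k_def using N_pos
    by (simp add: sum_divide_distrib[symmetric]
        power_mult_distrib sum_distrib_left[symmetric] sum_centered_ap_square field_simps)
  have "(cubes - real N ^ 3 - real N) * k \<le> real (card D) - real N"
    using total e_le f_le unfolding sum_g sum_a by (simp add: field_simps of_nat_diff)
  then show ?thesis by (simp add: k_def)
qed

end

section \<open>The excess over the trivial bound\<close>

context queen_cover begin

text \<open>
  The third weighting. If a wide and a core diagonal meet in a square, then both its
  coordinates have the parity of $N$, so neither its row nor its column is required; this is
  the only way in which wide and core weights come together. On a square
  with at most one required diagonal, nonnegativity of \<open>wide_weight\<close> or the crude bounds
  \<open>col_weight \<le> 53/200\<close> and \<open>core_weight \<le> 47/100\<close> suffice.
\<close>

lemma card_ge_masses:
  assumes \<xi>: "real N - real f \<le> 317/400 * real N" "real N - real e \<le> 317/400 * real N"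
    and ef: "real e \<le> 1/4 * real N" "real f \<le> 1/4 * real N"
  shows "real N * (3248/10000 + (wide_mass (real (N - f) / real N) + core_mass (real f / real N))
      + (wide_mass (real (N - e) / real N) + core_mass (real e / real N))) - 8 \<le> real (card D)"
proof -
  define g where "g m = col_weight (real_of_int m / real N)" for m
  define a where "a v = wide_weight (real_of_int v / real N)" for v
  define b where "b v = core_weight (real_of_int v / real N)" for v
  have scale: "\<bar>real_of_int v / real N\<bar> \<le> c" if "\<bar>real_of_int v\<bar> \<le> c * real N" for v c
    using that N_pos by (simp add: abs_divide field_simps)
  have g: "0 \<le> g x" "g x \<le> 53/200" if "\<bar>x\<bar> \<le> int N" for x
    unfolding g_def by (rule col_weight_bounds; rule scale; use that in linarith)+
  have a0: "0 \<le> a v" for v unfolding a_def by (rule wide_weight_nonneg)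
  have a1: "a v \<le> 53/100" if "v \<in> even_lines (N - f) \<union> even_lines (N - e)" for v
    unfolding a_def
  proof (rule wide_weight_le, rule scale)
    from that obtain X where X: "v \<in> even_lines X" "real X \<le> 317/400 * real N"
      using \<xi> e_le f_le by (metis Un_iff of_nat_diff)
    then obtain m where "v = 2 * m" "\<bar>m\<bar> < int X"
      by (auto simp: even_lines_def centered_ap_iff)
    with X show "\<bar>real_of_int v\<bar> \<le> 317/200 * real N" by linarith
  qed
  have b0: "0 \<le> b v" if "v \<in> even_lines e \<union> even_lines f" for v
    unfolding b_def
  proof (rule core_weight_bounds(2), rule scale)
    from that obtain X where X: "v \<in> even_lines X" "real X \<le> 1/4 * real N"
      using ef by blast
    then obtain m where "v = 2 * m" "\<bar>m\<bar> < int X"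
      by (auto simp: even_lines_def centered_ap_iff)
    with X show "\<bar>real_of_int v\<bar> \<le> 1/2 * real N" by linarith
  qed
  have b1: "b v \<le> 47/100" for v unfolding b_def by (rule core_weight_bounds(1))
  have "2 * sum g (centered_ap N)
      + (\<Sum>m\<in>centered_ap (N - f). a (2 * m)) + (\<Sum>m\<in>centered_ap e. b (2 * m))
      + (\<Sum>m\<in>centered_ap (N - e). a (2 * m)) + (\<Sum>m\<in>centered_ap f. b (2 * m)) \<le> real (card D)"
  proof (rule total_weight_le_card)
    fix x y :: int assume x: "\<bar>x\<bar> \<le> int N" and y: "\<bar>y\<bar> \<le> int N"
    have gx: "weight_on (centered_ap N) g x \<le> g x" "weight_on (centered_ap N) g y \<le> g y"
      using g x y by (auto simp: weight_on_def)
    have wide: "g x + g y + a (y - x) + a (x + y) \<le> 1"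
    proof -
      have "\<bar>real_of_int x / real N\<bar> \<le> 1" "\<bar>real_of_int y / real N\<bar> \<le> 1"
        using x y by (intro scale; linarith)+
      then show ?thesis unfolding g_def a_def
        using col_wide_weight_le by (simp add: diff_divide_distrib add_divide_distrib)
    qed
    have core: "g x + g y + b (y - x) + b (x + y) \<le> 1"
      unfolding g_def b_def using col_core_weight_le by (simp add: diff_divide_distrib add_divide_distrib)
    have mixed: "x \<notin> centered_ap N \<and> y \<notin> centered_ap N"
      if "y - x \<in> even_lines (N - f) \<and> x + y \<in> even_lines f \<or> y - x \<in> even_lines e \<and> x + y \<in> even_lines (N - e)"
    proof -
      have half: "\<exists>i. v = 2 * i \<and> odd (i + int X)" if "v \<in> even_lines X" for v X
        using that by (auto simp: even_lines_def centered_ap_iff)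
      from that obtain i j where ij: "y - x = 2 * i" "x + y = 2 * j"
        and "odd (i + int (N - f)) \<and> odd (j + int f) \<or> odd (i + int e) \<and> odd (j + int (N - e))"
        using half by metis
      then have "even (i + j + int N)" using e_le f_le by presburger
      moreover have "y = i + j" "x = j - i" using ij by auto
      ultimately show ?thesis unfolding centered_ap_iff by presburger
    qed
    note disj = parity_classes_disjoint[of "y - x"] parity_classes_disjoint[of "x + y"]
    note facts = gx g[OF x] g[OF y] a0[of "y - x"] a0[of "x + y"] a1[of "y - x"] a1[of "x + y"]
      b1[of "y - x"] b1[of "x + y"] wide core
    consider "y - x \<in> even_lines (N - f)" "x + y \<in> even_lines (N - e)"
      | "y - x \<in> even_lines (N - f)" "x + y \<in> even_lines f"
      | "y - x \<in> even_lines (N - f)" "x + y \<notin> even_lines (N - e)" "x + y \<notin> even_lines f"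
      | "y - x \<in> even_lines e" "x + y \<in> even_lines (N - e)"
      | "y - x \<in> even_lines e" "x + y \<in> even_lines f"
      | "y - x \<in> even_lines e" "x + y \<notin> even_lines (N - e)" "x + y \<notin> even_lines f"
      | "y - x \<notin> even_lines (N - f)" "y - x \<notin> even_lines e" by blast
    then show "weight_on (centered_ap N) g x + weight_on (centered_ap N) g y
      + weight_on (even_lines (N - f)) a (y - x) + weight_on (even_lines e) b (y - x)
      + weight_on (even_lines (N - e)) a (x + y) + weight_on (even_lines f) b (x + y) \<le> 1"
    proof cases
      case 1
      then show ?thesis using disj facts by (simp add: weight_on_def[of "even_lines _"])
    next
      case 2
      then have "weight_on (centered_ap N) g x = 0" "weight_on (centered_ap N) g y = 0"
        using mixed by (auto simp: weight_on_def)
      then show ?thesis using 2 disj facts by (auto simp: weight_on_def[of "even_lines _"])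
    next
      case 3
      then show ?thesis using disj facts by (auto simp: weight_on_def[of "even_lines _"])
    next
      case 4
      then have "weight_on (centered_ap N) g x = 0" "weight_on (centered_ap N) g y = 0"
        using mixed by (auto simp: weight_on_def)
      then show ?thesis using 4 disj facts by (auto simp: weight_on_def[of "even_lines _"])
    next
      case 5
      then show ?thesis using disj facts by (auto simp: weight_on_def[of "even_lines _"])
    next
      case 6
      then show ?thesis using disj facts by (auto simp: weight_on_def[of "even_lines _"])
    next
      case 7
      then show ?thesis using disj facts by (auto simp: weight_on_def[of "even_lines _"])
    qed
  qed (use g a0 b0 in \<open>auto simp: centered_ap_iff\<close>)
  moreover have "1624/10000 * real N - 1 \<le> sum g (centered_ap N)"
    unfolding g_def by (rule sum_col_weight_ge[OF N_pos])
  moreover have "real N * wide_mass (real (N - f) / real N) - 3 \<le> (\<Sum>m\<in>centered_ap (N - f). a (2 * m))"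
    "real N * wide_mass (real (N - e) / real N) - 3 \<le> (\<Sum>m\<in>centered_ap (N - e). a (2 * m))"
    unfolding a_def using ef N_pos e_le f_le by (intro sum_wide_weight_ge[OF N_pos]; simp add: of_nat_diff)+
  moreover have "real N * core_mass (real e / real N) \<le> (\<Sum>m\<in>centered_ap e. b (2 * m))"
    "real N * core_mass (real f / real N) \<le> (\<Sum>m\<in>centered_ap f. b (2 * m))"
    unfolding b_def by (intro sum_core_weight_ge[OF N_pos])+
  ultimately show ?thesis by (simp add: algebra_simps)
qed

text \<open>
  Put $f/N = \frac12 - s$ and $e/N = \frac12 - t$. The total of the cubes is then
  $N^3 (\frac12 + 3(s^2 + t^2))$, and the parallelogram weightings force it to be close to $N^3$, that
  is, $s^2 + t^2 \approx \frac16$. As $s$ and $t$ are almost equal and $s + t \ge 0$, both are close to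
  $1/\sqrt{12} \approx 0.2887$, inside the range where \<open>mass_ge\<close> applies.
\<close>

lemma card_gt:
  assumes N: "200000 \<le> N" and ef: "e + f < N"
  shows "real (card D) > real N + real N / 8000"
proof (rule ccontr)
  assume "\<not> ?thesis"
  then have small: "real (card D) - real N \<le> real N / 8000" by simp
  define n where "n = real N"
  have n: "200000 \<le> n" using N by (simp add: n_def)
  define s t where "s = 1/2 - real f / n" and "t = 1/2 - real e / n"
  have ef_eq: "real f = n * (1/2 - s)" "real e = n * (1/2 - t)"
    "real (N - f) = n * (1/2 + s)" "real (N - e) = n * (1/2 + t)"
    using n e_le f_le by (auto simp: s_def t_def n_def of_nat_diff field_simps)
  have "real (N - f) + real e \<le> real (card D)" "real (N - e) + real f \<le> real (card D)"
    using card_ge_diagonals by linarith+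
  then have "n * (s - t) \<le> n * (1/8000)" "n * (t - s) \<le> n * (1/8000)"
    using small unfolding ef_eq n_def[symmetric] by (simp_all add: algebra_simps)
  then have st: "t - s \<le> 1/8000" "s - t \<le> 1/8000" using n by simp_all
  have "real e + real f \<le> n" using ef by (simp add: n_def)
  then have "0 \<le> n * (s + t)" unfolding ef_eq by (simp add: algebra_simps)
  then have st0: "0 \<le> s + t" using n by (simp add: zero_le_mult_iff)
  have cubes: "cubes = n^3 * (1/2 + 3 * (s^2 + t^2))"
    unfolding ef_eq by (simp add: power2_eq_square power3_eq_cube field_simps)
  have "(n^3 - cubes) / (6 * n^2) \<le> n / 8000"
    using excess_ge_cubes_deficit small unfolding n_def by (rule order_trans)
  then have "n^3 * (1/2 - 3 * (s^2 + t^2)) \<le> n^3 * (6/8000)"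
    using n unfolding cubes by (simp add: field_simps power2_eq_square power3_eq_cube)
  then have lower: "1/2 - 3 * (s^2 + t^2) \<le> 6/8000" using n by simp
  have "(cubes - n^3 - n) / (3 * n^2) \<le> n / 8000"
    using excess_ge_cubes_surplus small unfolding n_def by (rule order_trans)
  then have "n^3 * (3 * (s^2 + t^2) - 1/2) \<le> n^3 * (3/8000) + n"
    using n unfolding cubes by (simp add: field_simps power2_eq_square power3_eq_cube)
  moreover have "n \<le> n^3 * (1/8000)"
  proof -
    have "8000 \<le> n * n" using n mult_mono[of 8000 n 1 n] by simp
    then have "n * 8000 \<le> n * (n * n)" using n by (intro mult_left_mono) auto
    then show ?thesis by (simp add: power3_eq_cube)
  qed
  ultimately have "n^3 * (3 * (s^2 + t^2) - 1/2) \<le> n^3 * (4/8000)" by linarith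
  then have upper: "3 * (s^2 + t^2) - 1/2 \<le> 4/8000" using n by simp
  have "36/125 \<le> u \<and> u \<le> 117/400" if "u - v \<le> 1/8000" "v - u \<le> 1/8000" "0 \<le> u + v" 
    "1/2 - 3 * (u^2 + v^2) \<le> 6/8000" "3 * (u^2 + v^2) - 1/2 \<le> 4/8000" for u v :: real
  proof (intro conjI leI notI)
    assume "u < 36/125"
    then have "\<bar>u\<bar> \<le> 36/125" "\<bar>v\<bar> \<le> 2882/10000" using that(1-3) by auto
    then have "\<bar>u\<bar>^2 \<le> (36/125)^2" "\<bar>v\<bar>^2 \<le> (2882/10000)^2" by (intro power_mono; simp)+
    then show False using that(4) by (simp add: power2_eq_square)
  next
    assume "117/400 < u"
    then have "292/1000 \<le> u" "292/1000 \<le> v" using that(1-3) by auto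
    then have "(292/1000)^2 \<le> u^2" "(292/1000)^2 \<le> v^2" by (intro power_mono; simp)+
    then show False using that(5) by (simp add: power2_eq_square)
  qed
  from this[of s t] this[of t s] have range: "36/125 \<le> s" "s \<le> 117/400" "36/125 \<le> t" "t \<le> 117/400"
    using st st0 lower upper by (auto simp: add.commute)
  have "n * (3248/10000 + (wide_mass (1/2 + s) + core_mass (1/2 - s))
      + (wide_mass (1/2 + t) + core_mass (1/2 - t))) - 8 \<le> real (card D)"
  proof -
    have bd: "real N - real f \<le> 317/400 * real N" "real N - real e \<le> 317/400 * real N"
      "real e \<le> 1/4 * real N" "real f \<le> 1/4 * real N"
    proof -
      have "n * (36/125) \<le> n * s" "n * s \<le> n * (117/400)" "n * (36/125) \<le> n * t" "n * t \<le> n * (117/400)"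
        using n range by (intro mult_left_mono; simp)+
      then show "real N - real f \<le> 317/400 * real N" "real N - real e \<le> 317/400 * real N"
        "real e \<le> 1/4 * real N" "real f \<le> 1/4 * real N"
        using n unfolding ef_eq n_def[symmetric] by (simp_all add: algebra_simps)
    qed
    have "real (N - f) / real N = 1/2 + s" "real (N - e) / real N = 1/2 + t"
      "real f / real N = 1/2 - s" "real e / real N = 1/2 - t"
      using n unfolding ef_eq n_def[symmetric] by simp_all
    then show ?thesis using card_ge_masses[OF bd] by (simp add: n_def)
  qed
  moreover have "3378/10000 \<le> wide_mass (1/2 + s) + core_mass (1/2 - s)"
    "3378/10000 \<le> wide_mass (1/2 + t) + core_mass (1/2 - t)"
    using mass_ge[of "1/2 + s"] mass_ge[of "1/2 + t"] range by simp_all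
  then have "n * (10004/10000) \<le> n * (3248/10000 + (wide_mass (1/2 + s) + core_mass (1/2 - s))
      + (wide_mass (1/2 + t) + core_mass (1/2 - t)))"
    using n by (intro mult_left_mono) auto
  ultimately show False using small n by (simp add: n_def)
qed

end

section \<open>Admissible seeds\<close>

lemma occupies_diff_diag: "occupies D (diff_diag n m) \<Longrightarrow> m \<in> (\<lambda>(x, y). y - x) ` D"
  by (force simp: occupies_def diff_diag_def)

lemma occupies_sum_diag: "occupies D (sum_diag n m) \<Longrightarrow> m \<in> (\<lambda>(x, y). x + y) ` D"
  by (force simp: occupies_def sum_diag_def)

lemma diff_diag_index_bound: "occupies D (diff_diag n m) \<Longrightarrow> \<bar>m\<bar> \<le> int n"
  by (auto simp: occupies_def diff_diag_def board_def)

lemma sum_diag_index_bound: "occupies D (sum_diag n m) \<Longrightarrow> \<bar>m\<bar> \<le> int n"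
  by (auto simp: occupies_def sum_diag_def board_def)

text \<open>
  The maxima in the parameters exist because only finitely many diagonals meet the board; hence
  they have their defining property.
\<close>

lemma e_par_occupied:
  assumes "meets_long_diagonals n D" and "\<bar>i\<bar> \<le> int (e_par n D)"
  shows "occupies D (diff_diag n (2 * i))"
proof -
  let ?P = "\<lambda>e. \<forall>i. \<bar>i\<bar> \<le> int e \<longrightarrow> occupies D (diff_diag n (2 * i))"
  have "?P (e_par n D)" unfolding e_par_def
  proof (rule GreatestI_nat)
    show "?P 0" using assms by (simp add: meets_long_diagonals_def)
    fix e assume "?P e"
    then have "occupies D (diff_diag n (2 * int e))" by simp
    then show "e \<le> n" using diff_diag_index_bound by fastforce
  qed
  then show ?thesis using assms by blast
qed

lemma f_par_occupied:
  assumes "meets_long_diagonals n D" and "\<bar>i\<bar> \<le> int (f_par n D)"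
  shows "occupies D (sum_diag n (2 * i))"
proof -
  let ?P = "\<lambda>e. \<forall>i. \<bar>i\<bar> \<le> int e \<longrightarrow> occupies D (sum_diag n (2 * i))"
  have "?P (f_par n D)" unfolding f_par_def
  proof (rule GreatestI_nat)
    show "?P 0" using assms by (simp add: meets_long_diagonals_def)
    fix e assume "?P e"
    then have "occupies D (sum_diag n (2 * int e))" by simp
    then show "e \<le> n" using sum_diag_index_bound by fastforce
  qed
  then show ?thesis using assms by blast
qed

lemma u_par_occupied:
  assumes "1 \<le> j" and "j \<le> u_par n D"
  shows "occupies D (diff_diag n (2 * int (e_par n D) + 4 * int j))"
    and "occupies D (diff_diag n (- (2 * int (e_par n D) + 4 * int j)))"
    and "occupies D (sum_diag n (2 * int (f_par n D) + 4 * int j))"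
    and "occupies D (sum_diag n (- (2 * int (f_par n D) + 4 * int j)))"
proof -
  let ?P = "\<lambda>u. \<forall>j\<in>{1..u}.
     (let a = 2 * int (e_par n D) + 4 * int j; b = 2 * int (f_par n D) + 4 * int j in
        occupies D (diff_diag n a) \<and> occupies D (diff_diag n (- a)) \<and>
        occupies D (sum_diag n b) \<and> occupies D (sum_diag n (- b)))"
  have "?P (u_par n D)" unfolding u_par_def
  proof (rule GreatestI_nat)
    show "?P 0" by simp
    fix u assume u: "?P u"
    show "u \<le> n"
    proof (cases "u = 0")
      case False
      then have "occupies D (diff_diag n (2 * int (e_par n D) + 4 * int u))"
        using u by (auto simp: Let_def)
      then show ?thesis using diff_diag_index_bound by fastforce
    qed simp
  qed
  then have "let a = 2 * int (e_par n D) + 4 * int j; b = 2 * int (f_par n D) + 4 * int j in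
        occupies D (diff_diag n a) \<and> occupies D (diff_diag n (- a)) \<and>
        occupies D (sum_diag n b) \<and> occupies D (sum_diag n (- b))"
    using assms by (meson atLeastAtMost_iff)
  then show "occupies D (diff_diag n (2 * int (e_par n D) + 4 * int j))"
    "occupies D (diff_diag n (- (2 * int (e_par n D) + 4 * int j)))"
    "occupies D (sum_diag n (2 * int (f_par n D) + 4 * int j))"
    "occupies D (sum_diag n (- (2 * int (f_par n D) + 4 * int j)))"
    by (simp_all add: Let_def)
qed

text \<open>
  A central block $|i| \le e$ together with $\pm(e + 2j)$, $1 \le j \le u$, consists of the
  progression with $e + 2u + 1$ members and the interlacing one with $e$ members.
\<close>

lemma even_lines_subset:
  fixes P :: "int \<Rightarrow> bool"
  assumes near: "\<And>i. \<bar>i\<bar> \<le> int e \<Longrightarrow> P (2 * i)"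
    and far: "\<And>j. 1 \<le> j \<Longrightarrow> j \<le> u \<Longrightarrow> P (2 * int e + 4 * int j) \<and> P (- (2 * int e + 4 * int j))"
  shows "v \<in> even_lines (e + 2 * u + 1) \<Longrightarrow> P v" and "v \<in> even_lines e \<Longrightarrow> P v"
proof -
  show "P v" if "v \<in> even_lines e"
    using that near by (auto simp: even_lines_def centered_ap_iff)
  assume "v \<in> even_lines (e + 2 * u + 1)"
  then obtain i where i: "v = 2 * i" "\<bar>i\<bar> \<le> int e + 2 * int u" "even (i + int e)"
    by (auto simp: even_lines_def centered_ap_iff)
  show "P v"
  proof (cases "\<bar>i\<bar> \<le> int e")
    case False
    define j where "j = nat ((\<bar>i\<bar> - int e) div 2)"
    have "even (\<bar>i\<bar> - int e)" using i(3) by (auto simp: abs_if)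
    then have ij: "\<bar>i\<bar> = int e + 2 * int j" using False by (simp add: j_def)
    then have "1 \<le> j" "j \<le> u" using False i(2) by auto
    then have "P (2 * int e + 4 * int j)" "P (- (2 * int e + 4 * int j))" using far by blast+
    moreover have "v = 2 * int e + 4 * int j \<or> v = - (2 * int e + 4 * int j)"
      using ij i(1) by (auto simp: abs_if split: if_splits)
    ultimately show ?thesis by auto
  qed (use i near in auto)
qed

text \<open>
  Since $e + f \equiv p \equiv N + 1 \pmod 2$, the inequality $e + f + 2u \ge N - 2$ gains 1. The
  locale wants $e + f + 2u = N - 1$ exactly, so $u$ is decreased, or, if already $e + f \ge N$, the
  parameters $e$ and $f$ are decreased and $u$ becomes 0.
\<close>

lemma admissible_seed_queen_cover:
  assumes seed: "admissible_seed n D" and "1 < n"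
  obtains N e f where "n = 2 * N + 1" and "queen_cover N e f D" and "e + f < N"
proof -
  obtain p where A: "type_A_cover n p D" and p: "p = 1 \<and> n mod 4 = 1 \<or> p = 0 \<and> n mod 4 = 3"
    using seed by (auto simp: admissible_seed_def)
  define N where "N = (n - 1) div 2"
  have n: "n = 2 * N + 1" using p unfolding N_def by presburger
  have pN: "p = (int N + 1) mod 2" using p n by presburger
  have N_pos: "0 < N" using \<open>1 < n\<close> n by simp
  define e' f' u' where "e' = e_par n D" and "f' = f_par n D" and "u' = u_par n D"
  have cover: "orthodox n p D" and long: "meets_long_diagonals n D"
    and par: "(int e' + int f') mod 2 = p" and "real e' + real f' + 2 * real u' \<ge> 2 * k_par n - 2"
    using A by (auto simp: type_A_cover_def p_cover_def e'_def f'_def u'_def)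
  then have "N \<le> e' + f' + 2 * u' + 2" by (simp add: k_par_def n)
  moreover have odd: "odd (e' + f' + N)" using par pN by presburger
  ultimately have large: "N \<le> e' + f' + 2 * u' + 1" by presburger
  define u where "u = (N - 1 - (e' + f')) div 2"
  define e where "e = min e' (N - 1)"
  define f where "f = min f' (N - 1 - e)"
  have euf: "e + f + 2 * u + 1 = N \<and> e \<le> e' \<and> f \<le> f' \<and> u \<le> u' \<and> (u > 0 \<longrightarrow> e = e' \<and> f = f')"
  proof (cases "e' + f' < N")
    case True
    then have e: "e = e'" and f: "f = f'" by (auto simp: e_def f_def)
    have "even (N - 1 - (e' + f'))" using odd True by presburger
    then have "2 * u = N - 1 - (e' + f')" by (simp add: u_def)
    then show ?thesis using True large unfolding e f by auto
  next
    case overlap: False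
    then show ?thesis using N_pos by (auto simp: e_def f_def u_def min_def)
  qed
  have D: "D \<subseteq> board n" using cover by (simp add: orthodox_def)
  have dbase: "\<bar>i\<bar> \<le> int e \<Longrightarrow> 2 * i \<in> (\<lambda>(x, y). y - x) ` D" for i
    by (rule occupies_diff_diag[of _ n], rule e_par_occupied[OF long]) (use euf e'_def in auto)
  have sbase: "\<bar>i\<bar> \<le> int f \<Longrightarrow> 2 * i \<in> (\<lambda>(x, y). x + y) ` D" for i
    by (rule occupies_sum_diag[of _ n], rule f_par_occupied[OF long]) (use euf f'_def in auto)
  have dfar: "2 * int e + 4 * int j \<in> (\<lambda>(x, y). y - x) ` D \<and> - (2 * int e + 4 * int j) \<in> (\<lambda>(x, y). y - x) ` D"
    and sfar: "2 * int f + 4 * int j \<in> (\<lambda>(x, y). x + y) ` D \<and> - (2 * int f + 4 * int j) \<in> (\<lambda>(x, y). x + y) ` D"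
    if "1 \<le> j" "j \<le> u" for j
  proof -
    have "e = e_par n D" "f = f_par n D" "j \<le> u_par n D"
      using that euf by (auto simp: e'_def f'_def u'_def)
    then show "2 * int e + 4 * int j \<in> (\<lambda>(x, y). y - x) ` D \<and> - (2 * int e + 4 * int j) \<in> (\<lambda>(x, y). y - x) ` D"
      "2 * int f + 4 * int j \<in> (\<lambda>(x, y). x + y) ` D \<and> - (2 * int f + 4 * int j) \<in> (\<lambda>(x, y). x + y) ` D"
      using u_par_occupied[OF that(1), of n D] occupies_diff_diag occupies_sum_diag by metis+
  qed
  have wide: "N - f = e + 2 * u + 1" "N - e = f + 2 * u + 1" using euf by auto
  have lines: "m \<in> fst ` D \<and> m \<in> snd ` D" if "m \<in> centered_ap N" for m
  proof -
    have "m mod 2 = p" "2 * \<bar>m\<bar> \<le> int n - 1"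
      using that pN n by (auto simp: centered_ap_iff mod_2_eq_odd)
    then have "occupies D (column n m)" "occupies D (row n m)"
      using cover by (auto simp: orthodox_def)
    then show ?thesis by (force simp: occupies_def column_def row_def)
  qed
  have "queen_cover N e f D"
  proof
    show "finite D"
      using D by (rule finite_subset)
        (rule finite_subset[of _ "{- int n..int n} \<times> {- int n..int n}"], auto simp: board_def)
    show "\<bar>x\<bar> \<le> int N \<and> \<bar>y\<bar> \<le> int N" if "(x, y) \<in> D" for x y
      using that D n by (auto simp: board_def)
    show "odd (e + f + N)" using euf by presburger
    show "centered_ap N \<subseteq> fst ` D" "centered_ap N \<subseteq> snd ` D" using lines by auto
    show "even_lines (N - f) \<subseteq> (\<lambda>(x, y). y - x) ` D" "even_lines e \<subseteq> (\<lambda>(x, y). y - x) ` D"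
      unfolding wide using even_lines_subset[of e "\<lambda>v. v \<in> (\<lambda>(x, y). y - x) ` D" u] dbase dfar by blast+
    show "even_lines (N - e) \<subseteq> (\<lambda>(x, y). x + y) ` D" "even_lines f \<subseteq> (\<lambda>(x, y). x + y) ` D"
      unfolding wide using even_lines_subset[of f "\<lambda>v. v \<in> (\<lambda>(x, y). x + y) ` D" u] sbase sfar by blast+
  qed (use N_pos euf in auto)
  then show thesis using that n euf by force
qed

lemma admissible_seed_card_gt:
  assumes seed: "admissible_seed n D" and n: "400001 \<le> n"
  shows "c0 * (real n - 1) < real (card D)"
proof -
  have "1 < n" using n by simp
  then obtain N e f where N: "n = 2 * N + 1" "queen_cover N e f D" "e + f < N"
    using admissible_seed_queen_cover[OF seed] by blast
  have "real (card D) > real N + real N / 8000"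
    using queen_cover.card_gt[OF N(2) _ N(3)] N(1) n by simp
  then show ?thesis using N(1) by (simp add: c0_def field_simps)
qed

lemma ratio_gt_c0:
  assumes "400001 \<le> n" and "c0 * (real n - 1) < d"
  shows "(d + r) / real n > c0 + (r - c0) / real n"
proof -
  have "c0 + (r - c0) / real n = (c0 * (real n - 1) + r) / real n"
    using assms(1) by (simp add: field_simps)
  also have "\<dots> < (d + r) / real n"
    using assms by (intro divide_strict_right_mono) auto
  finally show ?thesis .
qed

lemma liminf_ratio_ge:
  assumes "filterlim n at_top sequentially" and r: "c0 < r"
    and "\<And>i. 400001 \<le> n i \<Longrightarrow> c0 * (real (n i) - 1) < d i"
  shows "ereal c0 \<le> liminf (\<lambda>i. ereal ((d i + r) / real (n i)))"
proof (rule Liminf_bounded)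
  have "\<forall>\<^sub>F i in sequentially. 400001 \<le> n i"
    using assms(1) by (auto simp: filterlim_at_top)
  then show "\<forall>\<^sub>F i in sequentially. ereal c0 \<le> ereal ((d i + r) / real (n i))"
  proof eventually_elim
    case (elim i)
    have "c0 \<le> c0 + (r - c0) / real (n i)" using r by simp
    also have "\<dots> < (d i + r) / real (n i)" using ratio_gt_c0[OF elim assms(3)[OF elim]] .
    finally show ?case by simp
  qed
qed

theorem corollary10p2:
  "(\<forall>(n::nat) (D::square set). admissible_seed n D \<and> n \<ge> 400001 \<longrightarrow>
      ((real (card D) + 1) / real n > c0 + (1 - c0) / real n \<and> c0 + (1 - c0) / real n > c0) \<and>
      (independent_queens D \<longrightarrow>
         (real (card D) + 2) / real n > c0 + (2 - c0) / real n \<and> c0 + (2 - c0) / real n > c0)) \<and>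
   (\<forall>(n::nat \<Rightarrow> nat) (D::nat \<Rightarrow> square set).
      (\<forall>i. admissible_seed (n i) (D i)) \<and> filterlim n at_top sequentially \<longrightarrow>
      liminf (\<lambda>i. ereal ((real (card (D i)) + 1) / real (n i))) \<ge> ereal (1 / 2 + 1 / 16000) \<and>
      ((\<forall>i. independent_queens (D i)) \<longrightarrow>
         liminf (\<lambda>i. ereal ((real (card (D i)) + 2) / real (n i))) \<ge> ereal (1 / 2 + 1 / 16000)))"
proof (intro conjI allI impI)
  fix n :: nat and D :: "square set"
  assume "admissible_seed n D \<and> n \<ge> 400001"
  then have n: "400001 \<le> n" and card: "c0 * (real n - 1) < real (card D)"
    using admissible_seed_card_gt by auto
  show "(real (card D) + 1) / real n > c0 + (1 - c0) / real n"
    "(real (card D) + 2) / real n > c0 + (2 - c0) / real n"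
    using ratio_gt_c0[OF n card] by auto
  show "c0 + (1 - c0) / real n > c0" "c0 + (2 - c0) / real n > c0"
    using n by (simp_all add: c0_def)
next
  fix n :: "nat \<Rightarrow> nat" and D :: "nat \<Rightarrow> square set"
  assume "(\<forall>i. admissible_seed (n i) (D i)) \<and> filterlim n at_top sequentially"
  then have "ereal c0 \<le> liminf (\<lambda>i. ereal ((real (card (D i)) + r) / real (n i)))" if "c0 < r" for r
    using that admissible_seed_card_gt by (intro liminf_ratio_ge) auto
  moreover have "c0 = 1 / 2 + 1 / 16000" "c0 < 1" "c0 < 2" by (simp_all add: c0_def)
  ultimately show "liminf (\<lambda>i. ereal ((real (card (D i)) + 1) / real (n i))) \<ge> ereal (1 / 2 + 1 / 16000)"
    "liminf (\<lambda>i. ereal ((real (card (D i)) + 2) / real (n i))) \<ge> ereal (1 / 2 + 1 / 16000)"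
    by metis+
qed

end
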